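(* Let $R,R'$ be commutative rings with identity, $S,S'$ multiplicatively closed subsets of $R,R'$ respectively, and let $N,N'$ be non-zero submodules of a unital $R$-module $M$ and a unital $R'$-module $M'$, respectively. Consider $M\times M'$ as an $(R\times R')$-module. Then the following are equivalent. (1) $N\times N'$ is a weakly $S\times S'$-primary submodule of $M\times M'$. (2) $N$ is an $S$-primary submodule of $M$ and $(N':_{R'}M')\cap S'\neq\emptyset$, or $N'$ is an $S'$-primary submodule of $M'$ and $(N:_R M)\cap S\neq\emptyset$. (3) $N\times N'$ is an $S\times S'$-primary submodule of $M\times M'$.
   Context: A multiplicatively closed subset of a ring is a non-empty subset closed under multiplication. $(N:_R M)=\{r\in R: rM\subseteq N\}$. $R\times R'$ acts on $M\times M'$ componentwise. For a multiplicatively closed subset $S$ of $R$, a submodule $N$ of an $R$-module $M$ with $(N:_R M)\cap S=\emptyset$ is $S$-primary (resp. weakly $S$-primary) if there exists a fixed $s\in S$ such that for all $a\in R$ and $m\in M$, $am\in N$ (resp. $0\neq am\in N$) implies $sa\in\sqrt{(N:_R M)}$ or $sm\in N$. *)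

theory Defs
  imports "HOL-Algebra.Algebra"
begin

definition mult_closed_subset :: "('a, 'r) ring_scheme \<Rightarrow> 'a set \<Rightarrow> bool" where
  "mult_closed_subset R S \<longleftrightarrow>
     S \<subseteq> carrier R \<and> S \<noteq> {} \<and> (\<forall>x\<in>S. \<forall>y\<in>S. x \<otimes>\<^bsub>R\<^esub> y \<in> S)"

definition residual ::
    "('a, 'r) ring_scheme \<Rightarrow> ('a, 'b, 'm) module_scheme \<Rightarrow> 'b set \<Rightarrow> 'a set" where
  "residual R M N = {r \<in> carrier R. \<forall>m\<in>carrier M. r \<odot>\<^bsub>M\<^esub> m \<in> N}"

definition radical :: "('a, 'r) ring_scheme \<Rightarrow> 'a set \<Rightarrow> 'a set" where
  "radical R I = {r \<in> carrier R. \<exists>n::nat. n > 0 \<and> r [^]\<^bsub>R\<^esub> n \<in> I}"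

text \<open>In both predicates below, \<open>S\<close> is meant to satisfy \<^const>\<open>mult_closed_subset\<close>.\<close>

definition S_primary ::
    "('a, 'r) ring_scheme \<Rightarrow> 'a set \<Rightarrow> ('a, 'b, 'm) module_scheme \<Rightarrow> 'b set \<Rightarrow> bool" where
  "S_primary R S M N \<longleftrightarrow>
     submodule N R M \<and> residual R M N \<inter> S = {} \<and>
     (\<exists>s\<in>S. \<forall>a\<in>carrier R. \<forall>m\<in>carrier M.
        a \<odot>\<^bsub>M\<^esub> m \<in> N \<longrightarrow>
        s \<otimes>\<^bsub>R\<^esub> a \<in> radical R (residual R M N) \<or> s \<odot>\<^bsub>M\<^esub> m \<in> N)"

definition weakly_S_primary ::
    "('a, 'r) ring_scheme \<Rightarrow> 'a set \<Rightarrow> ('a, 'b, 'm) module_scheme \<Rightarrow> 'b set \<Rightarrow> bool" where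
  "weakly_S_primary R S M N \<longleftrightarrow>
     submodule N R M \<and> residual R M N \<inter> S = {} \<and>
     (\<exists>s\<in>S. \<forall>a\<in>carrier R. \<forall>m\<in>carrier M.
        a \<odot>\<^bsub>M\<^esub> m \<noteq> \<zero>\<^bsub>M\<^esub> \<and> a \<odot>\<^bsub>M\<^esub> m \<in> N \<longrightarrow>
        s \<otimes>\<^bsub>R\<^esub> a \<in> radical R (residual R M N) \<or> s \<odot>\<^bsub>M\<^esub> m \<in> N)"

text \<open>A module record extends a ring record, but its \<open>mult\<close> and \<open>one\<close> fields are
  irrelevant. \<^const>\<open>RDirProd\<close> therefore supplies the additive structure of the product,
  and only the componentwise scalar action has to be added.\<close>

definition MDirProd ::
    "('a, 'b, 'm) module_scheme \<Rightarrow> ('c, 'd, 'n) module_scheme \<Rightarrow> ('a \<times> 'c, 'b \<times> 'd) module" where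
  "MDirProd M M' = ring.extend (RDirProd M M')
     \<lparr> smult = (\<lambda>(a, a') (m, m'). (a \<odot>\<^bsub>M\<^esub> m, a' \<odot>\<^bsub>M'\<^esub> m')) \<rparr>"

lemma RDirProd_simps:
  "carrier (RDirProd R R') = carrier R \<times> carrier R'"
  "\<zero>\<^bsub>RDirProd R R'\<^esub> = (\<zero>\<^bsub>R\<^esub>, \<zero>\<^bsub>R'\<^esub>)"
  "\<one>\<^bsub>RDirProd R R'\<^esub> = (\<one>\<^bsub>R\<^esub>, \<one>\<^bsub>R'\<^esub>)"
  "(a, a') \<oplus>\<^bsub>RDirProd R R'\<^esub> (b, b') = (a \<oplus>\<^bsub>R\<^esub> b, a' \<oplus>\<^bsub>R'\<^esub> b')"
  "(a, a') \<otimes>\<^bsub>RDirProd R R'\<^esub> (b, b') = (a \<otimes>\<^bsub>R\<^esub> b, a' \<otimes>\<^bsub>R'\<^esub> b')"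
  by (simp_all add: RDirProd_def DirProd_def monoid.defs)

lemma MDirProd_simps:
  "carrier (MDirProd M M') = carrier M \<times> carrier M'"
  "\<zero>\<^bsub>MDirProd M M'\<^esub> = (\<zero>\<^bsub>M\<^esub>, \<zero>\<^bsub>M'\<^esub>)"
  "(m, m') \<oplus>\<^bsub>MDirProd M M'\<^esub> (n, n') = (m \<oplus>\<^bsub>M\<^esub> n, m' \<oplus>\<^bsub>M'\<^esub> n')"
  "(a, a') \<odot>\<^bsub>MDirProd M M'\<^esub> (m, m') = (a \<odot>\<^bsub>M\<^esub> m, a' \<odot>\<^bsub>M'\<^esub> m')"
  by (simp_all add: MDirProd_def RDirProd_def DirProd_def monoid.defs ring.defs)

lemma RDirProd_cring:
  assumes "cring R" "cring R'"
  shows "cring (RDirProd R R')"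
proof -
  interpret R: cring R by fact
  interpret R': cring R' by fact
  interpret P: ring "RDirProd R R'"
    by (rule RDirProd_ring) unfold_locales
  show ?thesis
    by unfold_locales (auto simp: RDirProd_simps R.m_comm R'.m_comm)
qed

lemma MDirProd_module:
  assumes "module R M" "module R' M'"
  shows "module (RDirProd R R') (MDirProd M M')"
proof -
  interpret M: module R M by fact
  interpret M': module R' M' by fact
  show ?thesis
  proof (rule moduleI)
    show "cring (RDirProd R R')"
      by (rule RDirProd_cring) unfold_locales
    show "abelian_group (MDirProd M M')"
    proof (rule abelian_groupI)
      fix x assume "x \<in> carrier (MDirProd M M')"
      then obtain m m' where x: "x = (m, m')" "m \<in> carrier M" "m' \<in> carrier M'"
        by (auto simp: MDirProd_simps)
      show "\<exists>y\<in>carrier (MDirProd M M'). y \<oplus>\<^bsub>MDirProd M M'\<^esub> x = \<zero>\<^bsub>MDirProd M M'\<^esub>"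
        by (rule bexI[of _ "(\<ominus>\<^bsub>M\<^esub> m, \<ominus>\<^bsub>M'\<^esub> m')"]) (use x in \<open>auto simp: MDirProd_simps M.M.l_neg M'.M.l_neg\<close>)
    qed (auto simp: MDirProd_simps M.M.add.m_ac M'.M.add.m_ac)
  qed (auto simp: MDirProd_simps RDirProd_simps M.smult_l_distr M'.smult_l_distr
         M.smult_r_distr M'.smult_r_distr M.smult_assoc1 M'.smult_assoc1)
qed

lemma mult_closed_subset_Times:
  assumes "mult_closed_subset R S" "mult_closed_subset R' S'"
  shows "mult_closed_subset (RDirProd R R') (S \<times> S')"
  using assms by (auto simp: mult_closed_subset_def RDirProd_simps)

end

theory Submission
  imports Defs
begin

text \<open>Membership in \<open>N \<times> N'\<close>, in its residual and in the radical of that residual is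
  componentwise. Suppose \<open>N \<times> N'\<close> is weakly primary with witness \<open>(s, s')\<close>. Multiplying
  \<open>(n, m')\<close> with \<open>0 \<noteq> n \<in> N\<close> by \<open>(1, 0)\<close> gives a non-zero element of \<open>N \<times> N'\<close>, so either a
  power of \<open>s\<close> lies in \<open>(N : M)\<close> or \<open>s' M' \<subseteq> N'\<close>. In the second case, \<open>(a, 1) (m, n')\<close> with
  \<open>0 \<noteq> n' \<in> N'\<close> is never zero when \<open>a m \<in> N\<close>, and therefore \<open>N\<close> is primary with witness \<open>s\<close>.
  Conversely, if \<open>N\<close> is primary with witness \<open>s\<close> and \<open>t' M' \<subseteq> N'\<close>, then \<open>(s, t')\<close> is a witness
  for \<open>N \<times> N'\<close>.\<close>

text \<open>Splitting off one factor, \<open>r\<close> first moves \<open>m\<close> into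
  \<open>N\<close>, and the remaining power keeps it there. This fails for exponent 0, whose power
  is the unit. It serves to pass to a common exponent in a product.\<close>

lemma residual_nat_pow:
  assumes "module R M" "submodule N R M" "r \<in> residual R M N" "n > 0"
  shows "r [^]\<^bsub>R\<^esub> (n::nat) \<in> residual R M N"
proof -
  interpret module R M by fact
  from \<open>n > 0\<close> obtain k where "n = Suc k"
    by (cases n) auto
  with assms(3) show ?thesis
    by (auto simp: residual_def smult_assoc1 intro: submoduleE(4)[OF assms(2)])
qed

lemma residual_mult:
  assumes "module R M" "r \<in> residual R M N" "a \<in> carrier R"
  shows "r \<otimes>\<^bsub>R\<^esub> a \<in> residual R M N"
proof -
  interpret module R M by fact
  from assms(2,3) show ?thesis
    by (auto simp: residual_def smult_assoc1)
qed

lemma residual_subset_radical: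
  assumes "module R M"
  shows "residual R M N \<subseteq> radical R (residual R M N)"
proof -
  interpret module R M by fact
  show ?thesis
    by (auto simp: radical_def residual_def intro!: exI[of _ "1::nat"])
qed

lemma mult_closed_subset_nat_pow:
  assumes "cring R" "mult_closed_subset R S" "s \<in> S" "n > 0"
  shows "s [^]\<^bsub>R\<^esub> (n::nat) \<in> S"
proof -
  interpret cring R by fact
  from \<open>n > 0\<close> show ?thesis
    \<comment> \<open>The induction starts at exponent 1, since \<open>S\<close> may lack the
      unit.\<close>
    by (induction n rule: nat_induct_non_zero)
      (use assms in \<open>auto simp: mult_closed_subset_def\<close>)
qed

lemma RDirProd_nat_pow:
  "(a, a') [^]\<^bsub>RDirProd R R'\<^esub> (n::nat) = (a [^]\<^bsub>R\<^esub> n, a' [^]\<^bsub>R'\<^esub> n)"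
  by (induction n) (simp_all add: RDirProd_simps)

locale submodule_pair = M: module R M + M': module R' M'
  for R :: "('a, 'r) ring_scheme" and M :: "('a, 'b, 'm) module_scheme"
    and R' :: "('c, 'p) ring_scheme" and M' :: "('c, 'd, 'n) module_scheme" +
  fixes N :: "'b set" and N' :: "'d set"
  assumes submodule_N: "submodule N R M" and submodule_N': "submodule N' R' M'"
begin

lemma zero_mem: "\<zero>\<^bsub>M\<^esub> \<in> N" "\<zero>\<^bsub>M'\<^esub> \<in> N'"
  using subgroup.one_closed[OF submodule.axioms(1)[OF submodule_N]]
    subgroup.one_closed[OF submodule.axioms(1)[OF submodule_N']] by simp_all

lemma submodule_Times: "submodule (N \<times> N') (RDirProd R R') (MDirProd M M')"
proof -
  interpret P: module "RDirProd R R'" "MDirProd M M'"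
    by (rule MDirProd_module) unfold_locales
  note N = M.submoduleE[OF submodule_N] and N' = M'.submoduleE[OF submodule_N']
  \<comment> \<open>Negation in the product has no equation in \<open>MDirProd_simps\<close>;
    uniqueness of additive inverses makes it componentwise.\<close>
  have minus: "\<ominus>\<^bsub>MDirProd M M'\<^esub> (m, m') = (\<ominus>\<^bsub>M\<^esub> m, \<ominus>\<^bsub>M'\<^esub> m')"
    if "m \<in> carrier M" "m' \<in> carrier M'" for m m'
    by (rule P.M.minus_equality)
      (use that in \<open>auto simp: MDirProd_simps M.M.l_neg M'.M.l_neg\<close>)
  show ?thesis
  proof (rule P.submoduleI)
    fix x assume "x \<in> N \<times> N'"
    then obtain m m' where x: "x = (m, m')" "m \<in> N" "m' \<in> N'"
      by auto
    then have "\<ominus>\<^bsub>MDirProd M M'\<^esub> x = (\<ominus>\<^bsub>M\<^esub> m, \<ominus>\<^bsub>M'\<^esub> m')"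
      using N(1) N'(1) minus by blast
    then show "\<ominus>\<^bsub>MDirProd M M'\<^esub> x \<in> N \<times> N'"
      using N(3) N'(3) x by simp
  qed (use N(1,4,5) N'(1,4,5) zero_mem in \<open>auto simp: MDirProd_simps RDirProd_simps\<close>)
qed

lemma residual_Times:
  "residual (RDirProd R R') (MDirProd M M') (N \<times> N') = residual R M N \<times> residual R' M' N'"
proof -
  have "(\<forall>m\<in>carrier M. \<forall>m'\<in>carrier M'. a \<odot>\<^bsub>M\<^esub> m \<in> N \<and> a' \<odot>\<^bsub>M'\<^esub> m' \<in> N') \<longleftrightarrow>
      (\<forall>m\<in>carrier M. a \<odot>\<^bsub>M\<^esub> m \<in> N) \<and> (\<forall>m'\<in>carrier M'. a' \<odot>\<^bsub>M'\<^esub> m' \<in> N')" for a a'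
    \<comment> \<open>Splitting the joint quantifier requires both carriers to be non-empty, which
      the zeros witness.\<close>
    using M.zero_closed M'.zero_closed by blast
  then show ?thesis
    by (auto simp: residual_def RDirProd_simps MDirProd_simps)
qed

text \<open>The two coordinates may enter their residuals at different exponents \<open>i\<close>
  and \<open>j\<close>. The exponent \<open>i * j\<close> serves both, because positive powers do
  not leave a residual.\<close>

lemma radical_residual_Times:
  "radical (RDirProd R R') (residual (RDirProd R R') (MDirProd M M') (N \<times> N')) =
    radical R (residual R M N) \<times> radical R' (residual R' M' N')"
proof -
  have "\<exists>k::nat. k > 0 \<and> a [^]\<^bsub>R\<^esub> k \<in> residual R M N \<and> a' [^]\<^bsub>R'\<^esub> k \<in> residual R' M' N'"
    if "a \<in> carrier R" "a' \<in> carrier R'" "i > 0" "j > 0"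
      "a [^]\<^bsub>R\<^esub> i \<in> residual R M N" "a' [^]\<^bsub>R'\<^esub> j \<in> residual R' M' N'"
    for a a' and i j :: nat
  proof (intro exI conjI)
    show "a [^]\<^bsub>R\<^esub> (i * j) \<in> residual R M N"
      using residual_nat_pow[OF M.module_axioms submodule_N that(5,4)] that(1)
      by (simp add: M.R.nat_pow_pow)
    show "a' [^]\<^bsub>R'\<^esub> (i * j) \<in> residual R' M' N'"
      using residual_nat_pow[OF M'.module_axioms submodule_N' that(6,3)] that(2)
      by (simp add: M'.R.nat_pow_pow mult.commute)
  qed (use that in simp)
  then show ?thesis
    unfolding residual_Times by (fastforce simp: radical_def RDirProd_simps RDirProd_nat_pow)
qed

text \<open>The parameter \<open>P\<close> allows for the primary and the weakly primary condition, where it is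
  \<open>True\<close> and the non-vanishing of \<open>(a, a') (m, m')\<close>, respectively.\<close>

definition Times_witness :: "('b \<Rightarrow> 'd \<Rightarrow> bool) \<Rightarrow> 'a \<Rightarrow> 'c \<Rightarrow> bool" where
  "Times_witness P s s' \<longleftrightarrow>
    (\<forall>a\<in>carrier R. \<forall>a'\<in>carrier R'. \<forall>m\<in>carrier M. \<forall>m'\<in>carrier M'.
      P (a \<odot>\<^bsub>M\<^esub> m) (a' \<odot>\<^bsub>M'\<^esub> m') \<and> a \<odot>\<^bsub>M\<^esub> m \<in> N \<and> a' \<odot>\<^bsub>M'\<^esub> m' \<in> N' \<longrightarrow>
      s \<otimes>\<^bsub>R\<^esub> a \<in> radical R (residual R M N) \<and> s' \<otimes>\<^bsub>R'\<^esub> a' \<in> radical R' (residual R' M' N') \<or>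
      s \<odot>\<^bsub>M\<^esub> m \<in> N \<and> s' \<odot>\<^bsub>M'\<^esub> m' \<in> N')"

lemma Times_witnessI:
  assumes "\<And>a a' m m'. \<lbrakk>a \<in> carrier R; a' \<in> carrier R'; m \<in> carrier M; m' \<in> carrier M';
      P (a \<odot>\<^bsub>M\<^esub> m) (a' \<odot>\<^bsub>M'\<^esub> m'); a \<odot>\<^bsub>M\<^esub> m \<in> N; a' \<odot>\<^bsub>M'\<^esub> m' \<in> N'\<rbrakk> \<Longrightarrow>
      s \<otimes>\<^bsub>R\<^esub> a \<in> radical R (residual R M N) \<and> s' \<otimes>\<^bsub>R'\<^esub> a' \<in> radical R' (residual R' M' N') \<or>
      s \<odot>\<^bsub>M\<^esub> m \<in> N \<and> s' \<odot>\<^bsub>M'\<^esub> m' \<in> N'"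
  shows "Times_witness P s s'"
  unfolding Times_witness_def by (intro ballI impI, elim conjE) (rule assms)

lemma Times_witnessD:
  assumes "Times_witness P s s'"
    and "a \<in> carrier R" "a' \<in> carrier R'" "m \<in> carrier M" "m' \<in> carrier M'"
    and "P (a \<odot>\<^bsub>M\<^esub> m) (a' \<odot>\<^bsub>M'\<^esub> m')" "a \<odot>\<^bsub>M\<^esub> m \<in> N" "a' \<odot>\<^bsub>M'\<^esub> m' \<in> N'"
  shows "s \<otimes>\<^bsub>R\<^esub> a \<in> radical R (residual R M N) \<and> s' \<otimes>\<^bsub>R'\<^esub> a' \<in> radical R' (residual R' M' N') \<or>
      s \<odot>\<^bsub>M\<^esub> m \<in> N \<and> s' \<odot>\<^bsub>M'\<^esub> m' \<in> N'"
  using assms unfolding Times_witness_def by simp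

text \<open>The residual of the product meets \<open>S \<times> S'\<close> in the product of the two
  intersections, which is empty exactly when one factor is; hence the disjunction.\<close>

lemma S_primary_Times_iff:
  "S_primary (RDirProd R R') (S \<times> S') (MDirProd M M') (N \<times> N') \<longleftrightarrow>
    (residual R M N \<inter> S = {} \<or> residual R' M' N' \<inter> S' = {}) \<and>
    (\<exists>s\<in>S. \<exists>s'\<in>S'. Times_witness (\<lambda>_ _. True) s s')"
  \<comment> \<open>The radical is rewritten first: \<open>residual_Times\<close> would destroy the
    left-hand side of \<open>radical_residual_Times\<close>.\<close>
  unfolding S_primary_def radical_residual_Times unfolding residual_Times Times_witness_def
  by (simp add: submodule_Times RDirProd_simps MDirProd_simps Times_Int_Times)

lemma weakly_S_primary_Times_iff:
  "weakly_S_primary (RDirProd R R') (S \<times> S') (MDirProd M M') (N \<times> N') \<longleftrightarrow>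
    (residual R M N \<inter> S = {} \<or> residual R' M' N' \<inter> S' = {}) \<and>
    (\<exists>s\<in>S. \<exists>s'\<in>S'. Times_witness (\<lambda>x x'. x \<noteq> \<zero>\<^bsub>M\<^esub> \<or> x' \<noteq> \<zero>\<^bsub>M'\<^esub>) s s')"
  unfolding weakly_S_primary_def radical_residual_Times unfolding residual_Times Times_witness_def
  by (simp add: submodule_Times RDirProd_simps MDirProd_simps Times_Int_Times)

text \<open>This symmetry makes it enough to treat one of the two cases of the theorem.\<close>

lemma submodule_pair_swap: "submodule_pair R' M' R M N' N"
  by (intro submodule_pair.intro submodule_pair_axioms.intro M.module_axioms M'.module_axioms
      submodule_N submodule_N')

text \<open>A separate \<open>Q\<close>, rather than \<open>P\<close> with its arguments exchanged,
  lets the weak condition appear with its two disjuncts in the order used after the swap.\<close>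

lemma Times_witness_swap:
  assumes "Times_witness P s s'" and "\<And>x x'. Q x' x \<Longrightarrow> P x x'"
  shows "submodule_pair.Times_witness R' M' R M N' N Q s' s"
proof -
  interpret swap: submodule_pair R' M' R M N' N
    by (fact submodule_pair_swap)
  show ?thesis
    by (rule swap.Times_witnessI) (use Times_witnessD[OF assms(1)] assms(2) in metis)
qed

lemma S_primary_Times_swap:
  assumes "S_primary (RDirProd R R') (S \<times> S') (MDirProd M M') (N \<times> N')"
  shows "S_primary (RDirProd R' R) (S' \<times> S) (MDirProd M' M) (N' \<times> N)"
  using assms Times_witness_swap[of "\<lambda>_ _. True" _ _ "\<lambda>_ _. True"]
  unfolding S_primary_Times_iff submodule_pair.S_primary_Times_iff[OF submodule_pair_swap]
  by metis

lemma weakly_S_primary_Times_swap: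
  assumes "weakly_S_primary (RDirProd R R') (S \<times> S') (MDirProd M M') (N \<times> N')"
  shows "weakly_S_primary (RDirProd R' R) (S' \<times> S) (MDirProd M' M) (N' \<times> N)"
proof -
  from assms obtain s s' where "residual R M N \<inter> S = {} \<or> residual R' M' N' \<inter> S' = {}"
    and s: "s \<in> S" "s' \<in> S'" "Times_witness (\<lambda>x x'. x \<noteq> \<zero>\<^bsub>M\<^esub> \<or> x' \<noteq> \<zero>\<^bsub>M'\<^esub>) s s'"
    unfolding weakly_S_primary_Times_iff by blast
  moreover have "submodule_pair.Times_witness R' M' R M N' N
      (\<lambda>x' x. x' \<noteq> \<zero>\<^bsub>M'\<^esub> \<or> x \<noteq> \<zero>\<^bsub>M\<^esub>) s' s"
    by (rule Times_witness_swap[OF s(3)]) blast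
  ultimately show ?thesis
    unfolding submodule_pair.weakly_S_primary_Times_iff[OF submodule_pair_swap] by blast
qed

lemma weakly_S_primary_TimesD:
  assumes S: "mult_closed_subset R S" and S': "mult_closed_subset R' S'"
    and nonzero: "N \<noteq> {\<zero>\<^bsub>M\<^esub>}" "N' \<noteq> {\<zero>\<^bsub>M'\<^esub>}"
    and weak: "weakly_S_primary (RDirProd R R') (S \<times> S') (MDirProd M M') (N \<times> N')"
    and disjoint: "residual R M N \<inter> S = {}"
  shows "S_primary R S M N" "residual R' M' N' \<inter> S' \<noteq> {}"
proof -
  have N: "N \<subseteq> carrier M" and N': "N' \<subseteq> carrier M'"
    using M.submoduleE(1)[OF submodule_N] M'.submoduleE(1)[OF submodule_N'] .
  from weak obtain s s' where s: "s \<in> S" "s' \<in> S'"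
    and "Times_witness (\<lambda>x x'. x \<noteq> \<zero>\<^bsub>M\<^esub> \<or> x' \<noteq> \<zero>\<^bsub>M'\<^esub>) s s'"
    unfolding weakly_S_primary_Times_iff by blast
  note witness = Times_witnessD[OF this(3)]
  from s S S' have carrier: "s \<in> carrier R" "s' \<in> carrier R'"
    by (auto simp: mult_closed_subset_def)
  obtain n where n: "n \<in> N" "n \<noteq> \<zero>\<^bsub>M\<^esub>"
    using nonzero(1) zero_mem(1) by blast
  obtain n' where n': "n' \<in> N'" "n' \<noteq> \<zero>\<^bsub>M'\<^esub>"
    using nonzero(2) zero_mem(2) by blast
  \<comment> \<open>A positive power of \<open>s\<close> in the residual would also lie in
    \<open>S\<close>, against disjointness.\<close>
  have "s \<notin> radical R (residual R M N)"
    using mult_closed_subset_nat_pow[OF M.is_cring S s(1)] disjoint by (auto simp: radical_def)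
  then have "s' \<odot>\<^bsub>M'\<^esub> m' \<in> N'" if "m' \<in> carrier M'" for m'
    \<comment> \<open>The scalar 0 sends any \<open>m'\<close> into \<open>N'\<close>, while
      \<open>n\<close> keeps the product non-zero. The radical alternative would put
      \<open>s\<close> itself into the radical.\<close>
    using witness[of "\<one>\<^bsub>R\<^esub>" "\<zero>\<^bsub>R'\<^esub>" n m'] that n N carrier zero_mem by auto
  then have "s' \<in> residual R' M' N'"
    using carrier by (simp add: residual_def)
  then show "residual R' M' N' \<inter> S' \<noteq> {}"
    using s by blast
  have "s \<otimes>\<^bsub>R\<^esub> a \<in> radical R (residual R M N) \<or> s \<odot>\<^bsub>M\<^esub> m \<in> N"
    if "a \<in> carrier R" "m \<in> carrier M" "a \<odot>\<^bsub>M\<^esub> m \<in> N" for a m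
    \<comment> \<open>The second coordinate of the product is \<open>n'\<close>, so the weak
      condition applies even when \<open>a\<close> annihilates \<open>m\<close>.\<close>
    using witness[of a "\<one>\<^bsub>R'\<^esub>" m n'] that n' N' by auto
  then show "S_primary R S M N"
    unfolding S_primary_def using submodule_N disjoint s by blast
qed

text \<open>An element \<open>t'\<close> of the residual satisfies both alternatives on the second
  coordinate at once, so whichever one \<open>s\<close> yields on the first coordinate holds for the
  pair.\<close>

lemma S_primary_TimesI:
  assumes primary: "S_primary R S M N" and meets: "residual R' M' N' \<inter> S' \<noteq> {}"
  shows "S_primary (RDirProd R R') (S \<times> S') (MDirProd M M') (N \<times> N')"
proof -
  from primary obtain s where "residual R M N \<inter> S = {}" and "s \<in> S" and
    s: "\<And>a m. \<lbrakk>a \<in> carrier R; m \<in> carrier M; a \<odot>\<^bsub>M\<^esub> m \<in> N\<rbrakk> \<Longrightarrow>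
      s \<otimes>\<^bsub>R\<^esub> a \<in> radical R (residual R M N) \<or> s \<odot>\<^bsub>M\<^esub> m \<in> N"
    unfolding S_primary_def by blast
  from meets obtain t' where "t' \<in> S'" and t': "t' \<in> residual R' M' N'"
    by blast
  have radical: "t' \<otimes>\<^bsub>R'\<^esub> a' \<in> radical R' (residual R' M' N')" if "a' \<in> carrier R'" for a'
    using residual_mult[OF M'.module_axioms t' that]
      residual_subset_radical[OF M'.module_axioms] by blast
  have mem: "t' \<odot>\<^bsub>M'\<^esub> m' \<in> N'" if "m' \<in> carrier M'" for m'
    using t' that by (simp add: residual_def)
  have "Times_witness (\<lambda>_ _. True) s t'"
  proof (rule Times_witnessI)
    fix a a' m m'
    assume "a \<in> carrier R" "a' \<in> carrier R'" "m \<in> carrier M" "m' \<in> carrier M'" "a \<odot>\<^bsub>M\<^esub> m \<in> N"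
    then show "s \<otimes>\<^bsub>R\<^esub> a \<in> radical R (residual R M N) \<and> t' \<otimes>\<^bsub>R'\<^esub> a' \<in> radical R' (residual R' M' N') \<or>
        s \<odot>\<^bsub>M\<^esub> m \<in> N \<and> t' \<odot>\<^bsub>M'\<^esub> m' \<in> N'"
      using s[of a m] radical[of a'] mem[of m'] by simp
  qed
  then show ?thesis
    unfolding S_primary_Times_iff
    using \<open>residual R M N \<inter> S = {}\<close> \<open>s \<in> S\<close> \<open>t' \<in> S'\<close> by blast
qed

end

lemma S_primary_imp_weakly_S_primary: "S_primary R S M N \<Longrightarrow> weakly_S_primary R S M N"
  unfolding S_primary_def weakly_S_primary_def by blast

theorem theorem4:
  fixes R :: "('a, 'r) ring_scheme" and M :: "('a, 'b, 'm) module_scheme"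
    and R' :: "('c, 'p) ring_scheme" and M' :: "('c, 'd, 'n) module_scheme"
  assumes "cring R" and "cring R'"
    and "mult_closed_subset R S" and "mult_closed_subset R' S'"
    and "module R M" and "module R' M'"
    and "submodule N R M" and "N \<noteq> {\<zero>\<^bsub>M\<^esub>}"
    and "submodule N' R' M'" and "N' \<noteq> {\<zero>\<^bsub>M'\<^esub>}"
  shows "(weakly_S_primary (RDirProd R R') (S \<times> S') (MDirProd M M') (N \<times> N') \<longleftrightarrow>
            S_primary R S M N \<and> residual R' M' N' \<inter> S' \<noteq> {} \<or>
            S_primary R' S' M' N' \<and> residual R M N \<inter> S \<noteq> {})
       \<and> (S_primary R S M N \<and> residual R' M' N' \<inter> S' \<noteq> {} \<or>
            S_primary R' S' M' N' \<and> residual R M N \<inter> S \<noteq> {} \<longleftrightarrow>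
          S_primary (RDirProd R R') (S \<times> S') (MDirProd M M') (N \<times> N'))"
    (is "(?weak \<longleftrightarrow> ?factor) \<and> (?factor \<longleftrightarrow> ?strong)")
proof -
  interpret submodule_pair R M R' M' N N'
    using assms by (intro submodule_pair.intro submodule_pair_axioms.intro)
  interpret swap: submodule_pair R' M' R M N' N
    by (fact submodule_pair_swap)
  have "?factor" if ?weak
  proof -
    from that consider "residual R M N \<inter> S = {}" | "residual R' M' N' \<inter> S' = {}"
      unfolding weakly_S_primary_Times_iff by blast
    then show ?thesis
    proof cases
      case 1
      then show ?thesis
        using weakly_S_primary_TimesD[OF assms(3,4,8,10) that] by blast
    next
      case 2
      then show ?thesis
        using swap.weakly_S_primary_TimesD[OF assms(4,3,10,8) weakly_S_primary_Times_swap[OF that]]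
        by blast
    qed
  qed
  moreover have ?strong if ?factor
    using that
  proof (elim disjE conjE)
    assume "S_primary R S M N" "residual R' M' N' \<inter> S' \<noteq> {}"
    then show ?strong
      by (rule S_primary_TimesI)
  next
    assume "S_primary R' S' M' N'" "residual R M N \<inter> S \<noteq> {}"
    then show ?strong
      \<comment> \<open>The product \<open>N' \<times> N\<close> is shown to be primary first;
        exchanging the coordinates gives \<open>N \<times> N'\<close>.\<close>
      by (intro swap.S_primary_Times_swap swap.S_primary_TimesI)
  qed
  moreover have ?weak if ?strong
    using that by (rule S_primary_imp_weakly_S_primary)
  ultimately show ?thesis
    by blast
qed

end
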